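(* Let $\mu(\mathfrak g)$ denote the least $N$ such that the real Lie algebra $\mathfrak g$ has a faithful representation in $\mathfrak{gl}(N,\mathbb R)$. Let $L_{8.15}$ be the eight-dimensional real Lie algebra (under the commutator) of all matrices $$\begin{pmatrix}a&b&-h&0&d&e\\c&-a&0&-h&f&g\\0&0&a&b&0&d\\0&0&c&-a&0&f\\0&0&f&-d&0&2h\\0&0&0&0&0&0\end{pmatrix},\qquad a,b,c,d,e,f,g,h\in\mathbb R.$$ Then $\mu(L_{8.15})=6$.
   Context: $L_{8.15}$ is Turkowski's algebra with Levi factor $\mathfrak{sl}(2,\mathbb R)$ and radical the five-dimensional nilpotent Lie algebra $A_{5.3}$. *)

theory Defs
  imports "Jordan_Normal_Form.Matrix" "Jordan_Normal_Form.VS_Connect"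
begin

(* The fields mult and one, which module inherits from the ring record, play no role. *)
record ('a, 'b) lie_algebra = "('a, 'b) module" +
  lie_bracket :: "'b \<Rightarrow> 'b \<Rightarrow> 'b"

locale real_lie_algebra =
  Module.module "class_ring :: real ring" L for L :: "(real, 'b, 'm) lie_algebra_scheme" +
  assumes bracket_closed:
      "x \<in> carrier L \<Longrightarrow> y \<in> carrier L \<Longrightarrow> lie_bracket L x y \<in> carrier L"
    and bracket_add_left:
      "x \<in> carrier L \<Longrightarrow> y \<in> carrier L \<Longrightarrow> z \<in> carrier L \<Longrightarrow>
        lie_bracket L (x \<oplus>\<^bsub>L\<^esub> y) z = lie_bracket L x z \<oplus>\<^bsub>L\<^esub> lie_bracket L y z"
    and bracket_add_right:
      "x \<in> carrier L \<Longrightarrow> y \<in> carrier L \<Longrightarrow> z \<in> carrier L \<Longrightarrow>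
        lie_bracket L x (y \<oplus>\<^bsub>L\<^esub> z) = lie_bracket L x y \<oplus>\<^bsub>L\<^esub> lie_bracket L x z"
    and bracket_smult_left:
      "x \<in> carrier L \<Longrightarrow> y \<in> carrier L \<Longrightarrow>
        lie_bracket L (c \<odot>\<^bsub>L\<^esub> x) y = c \<odot>\<^bsub>L\<^esub> lie_bracket L x y"
    and bracket_smult_right:
      "x \<in> carrier L \<Longrightarrow> y \<in> carrier L \<Longrightarrow>
        lie_bracket L x (c \<odot>\<^bsub>L\<^esub> y) = c \<odot>\<^bsub>L\<^esub> lie_bracket L x y"
    and bracket_self: "x \<in> carrier L \<Longrightarrow> lie_bracket L x x = \<zero>\<^bsub>L\<^esub>"
    and jacobi:
      "x \<in> carrier L \<Longrightarrow> y \<in> carrier L \<Longrightarrow> z \<in> carrier L \<Longrightarrow>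
        lie_bracket L x (lie_bracket L y z) \<oplus>\<^bsub>L\<^esub> lie_bracket L y (lie_bracket L z x)
          \<oplus>\<^bsub>L\<^esub> lie_bracket L z (lie_bracket L x y) = \<zero>\<^bsub>L\<^esub>"

definition lie_hom ::
  "(real, 'b, 'm) lie_algebra_scheme \<Rightarrow> (real, 'c, 'n) lie_algebra_scheme \<Rightarrow> ('b \<Rightarrow> 'c) set"
  where "lie_hom L M = {\<phi>. \<phi> \<in> carrier L \<rightarrow> carrier M
    \<and> (\<forall>x\<in>carrier L. \<forall>y\<in>carrier L. \<phi> (x \<oplus>\<^bsub>L\<^esub> y) = \<phi> x \<oplus>\<^bsub>M\<^esub> \<phi> y)
    \<and> (\<forall>c. \<forall>x\<in>carrier L. \<phi> (c \<odot>\<^bsub>L\<^esub> x) = c \<odot>\<^bsub>M\<^esub> \<phi> x)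
    \<and> (\<forall>x\<in>carrier L. \<forall>y\<in>carrier L.
          \<phi> (lie_bracket L x y) = lie_bracket M (\<phi> x) (\<phi> y))}"

definition gl :: "nat \<Rightarrow> (real, real mat) lie_algebra"
  where "gl n = module.extend (module_mat TYPE(real) n n)
    (lie_algebra.fields (\<lambda>A B. A * B - B * A))"

definition faithful_rep :: "(real, 'b, 'm) lie_algebra_scheme \<Rightarrow> nat \<Rightarrow> ('b \<Rightarrow> real mat) \<Rightarrow> bool"
  where "faithful_rep L N \<rho> \<longleftrightarrow> \<rho> \<in> lie_hom L (gl N) \<and> inj_on \<rho> (carrier L)"

(* By Ado's theorem the set of admissible N is nonempty for finite-dimensional L. *)
definition mu :: "(real, 'b, 'm) lie_algebra_scheme \<Rightarrow> nat"
  where "mu L = (LEAST N. \<exists>\<rho>. faithful_rep L N \<rho>)"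

definition L815_mat :: "real \<Rightarrow> real \<Rightarrow> real \<Rightarrow> real \<Rightarrow> real \<Rightarrow> real \<Rightarrow> real \<Rightarrow> real \<Rightarrow> real mat"
  where "L815_mat a b c d e f g h = mat_of_rows_list 6
    [[a,  b, -h,  0, d, e],
     [c, -a,  0, -h, f, g],
     [0,  0,  a,  b, 0, d],
     [0,  0,  c, -a, 0, f],
     [0,  0,  f, -d, 0, 2 * h],
     [0,  0,  0,  0, 0, 0]]"

definition L815 :: "(real, real mat) lie_algebra"
  where "L815 = (gl 6)\<lparr>carrier := {L815_mat a b c d e f g h | a b c d e f g h. True}\<rparr>"

lemma gl_simps [simp]:
  "carrier (gl n) = carrier_mat n n"
  "A \<oplus>\<^bsub>gl n\<^esub> B = A + B"
  "\<zero>\<^bsub>gl n\<^esub> = 0\<^sub>m n n"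
  "c \<odot>\<^bsub>gl n\<^esub> A = c \<cdot>\<^sub>m A"
  "lie_bracket (gl n) A B = A * B - B * A"
  by (simp_all add: gl_def module_mat_def module.defs lie_algebra.defs)

lemma L815_simps [simp]:
  "carrier L815 = {L815_mat a b c d e f g h | a b c d e f g h. True}"
  "A \<oplus>\<^bsub>L815\<^esub> B = A + B"
  "\<zero>\<^bsub>L815\<^esub> = 0\<^sub>m 6 6"
  "c \<odot>\<^bsub>L815\<^esub> A = c \<cdot>\<^sub>m A"
  "lie_bracket L815 A B = A * B - B * A"
  using gl_simps[of 6] by (simp_all add: L815_def)

lemma L815_mat_carrier [simp]: "L815_mat a b c d e f g h \<in> carrier_mat 6 6"
  by (rule carrier_matI) (simp_all add: L815_mat_def mat_of_rows_list_def)

lemma L815_mat_index: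
  "i < 6 \<Longrightarrow> j < 6 \<Longrightarrow> L815_mat a b c d e f g h $$ (i, j) =
   [[a,  b, -h,  0, d, e],
    [c, -a,  0, -h, f, g],
    [0,  0,  a,  b, 0, d],
    [0,  0,  c, -a, 0, f],
    [0,  0,  f, -d, 0, 2 * h],
    [0,  0,  0,  0, 0, 0]] ! i ! j"
  by (simp add: L815_mat_def mat_of_rows_list_def)

lemma mat6_eqI:
  assumes "A \<in> carrier_mat 6 6" "B \<in> carrier_mat 6 6"
    and "\<forall>i\<in>{0, 1, 2, 3, 4, 5}. \<forall>j\<in>{0, 1, 2, 3, 4, 5}. A $$ (i, j) = B $$ (i, j)"
  shows "A = B"
proof (rule eq_matI)
  have *: "i \<in> {0, 1, 2, 3, 4, 5}" if "i < 6" for i :: nat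
    using that by auto
  show "A $$ (i, j) = B $$ (i, j)" if "i < dim_row B" "j < dim_col B" for i j
    using assms that * by (metis carrier_matD)
qed (use assms in auto)

(* Together with L815_mat_add and L815_mat_smult: the parametrization is a linear
   bijection from R^8, so L815 is eight-dimensional. *)
lemma L815_mat_eq_iff:
  "L815_mat a b c d e f g h = L815_mat a' b' c' d' e' f' g' h' \<longleftrightarrow>
    a = a' \<and> b = b' \<and> c = c' \<and> d = d' \<and> e = e' \<and> f = f' \<and> g = g' \<and> h = h'"
  (is "?A = ?B \<longleftrightarrow> ?R")
proof
  assume "?A = ?B"
  then have *: "?A $$ (i, j) = ?B $$ (i, j)" for i j by simp
  show ?R
    using *[of 0 0] *[of 0 1] *[of 1 0] *[of 0 4] *[of 0 5] *[of 1 4] *[of 1 5] *[of 0 2]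
    by (simp add: L815_mat_index)
qed simp

lemma L815_mat_add:
  "L815_mat a b c d e f g h + L815_mat a' b' c' d' e' f' g' h' =
    L815_mat (a + a') (b + b') (c + c') (d + d') (e + e') (f + f') (g + g') (h + h')"
  by (rule mat6_eqI) (simp_all add: L815_mat_index carrier_matD[OF L815_mat_carrier])

lemma L815_mat_smult:
  "r \<cdot>\<^sub>m L815_mat a b c d e f g h =
    L815_mat (r * a) (r * b) (r * c) (r * d) (r * e) (r * f) (r * g) (r * h)"
  by (rule mat6_eqI) (simp_all add: L815_mat_index carrier_matD[OF L815_mat_carrier])

lemma L815_mat_zero: "0\<^sub>m 6 6 = L815_mat 0 0 0 0 0 0 0 0"
  by (rule mat6_eqI) (simp_all add: L815_mat_index carrier_matD[OF L815_mat_carrier])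

lemma sum6: "(\<Sum>i = 0..<(6::nat). f i) = f 0 + f 1 + f 2 + f 3 + f 4 + (f 5 :: real)"
  by (simp add: eval_nat_numeral)

lemma L815_mat_bracket:
  "L815_mat a b c d e f g h * L815_mat a' b' c' d' e' f' g' h'
    - L815_mat a' b' c' d' e' f' g' h' * L815_mat a b c d e f g h =
    L815_mat (b * c' - b' * c) (2 * (a * b' - a' * b)) (2 * (c * a' - c' * a))
      (a * d' - a' * d + b * f' - b' * f)
      (a * e' - a' * e + b * g' - b' * g + 3 * (d * h' - d' * h))
      (c * d' - c' * d - a * f' + a' * f)
      (c * e' - c' * e - a * g' + a' * g + 3 * (f * h' - f' * h))
      (d' * f - d * f')"
  by (rule mat6_eqI)
    (simp_all add: L815_mat_index carrier_matD[OF L815_mat_carrier] minus_carrier_mat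
      mult_carrier_mat[of _ 6 6] scalar_prod_def sum6 algebra_simps)

lemma L815_bracket_closed:
  "A \<in> carrier L815 \<Longrightarrow> B \<in> carrier L815 \<Longrightarrow> A * B - B * A \<in> carrier L815"
  by (clarsimp simp only: L815_simps mem_Collect_eq) (metis L815_mat_bracket)

lemma L815_module: "Module.module (class_ring :: real ring) L815"
proof (rule moduleI)
  show "cring (class_ring :: real ring)"
    by (rule class_cring.cring_axioms)
  show "abelian_group L815"
  proof (rule abelian_groupI)
    fix x assume x: "x \<in> carrier L815"
    then obtain a b c d e f g h where "x = L815_mat a b c d e f g h" by auto
    then have "L815_mat (-a) (-b) (-c) (-d) (-e) (-f) (-g) (-h) + x = 0\<^sub>m 6 6"
      by (simp add: L815_mat_add L815_mat_zero)
    then show "\<exists>y\<in>carrier L815. y \<oplus>\<^bsub>L815\<^esub> x = \<zero>\<^bsub>L815\<^esub>"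
      by (simp only: L815_simps) blast
  next
    fix x y assume "x \<in> carrier L815" "y \<in> carrier L815"
    then show "x \<oplus>\<^bsub>L815\<^esub> y \<in> carrier L815"
      by (clarsimp simp only: L815_simps mem_Collect_eq) (metis L815_mat_add)
  next
    show "\<zero>\<^bsub>L815\<^esub> \<in> carrier L815"
      by (simp only: L815_simps mem_Collect_eq) (metis L815_mat_zero)
  qed (auto simp: L815_mat_add L815_mat_zero algebra_simps)
next
  fix r :: real and x assume "x \<in> carrier L815"
  then show "r \<odot>\<^bsub>L815\<^esub> x \<in> carrier L815"
    by (clarsimp simp only: L815_simps mem_Collect_eq) (metis L815_mat_smult)
qed (auto simp: L815_mat_add L815_mat_smult algebra_simps)

lemma real_lie_algebra_L815: "real_lie_algebra L815"
proof (intro real_lie_algebra.intro L815_module real_lie_algebra_axioms.intro)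
  fix x y assume "x \<in> carrier L815" "y \<in> carrier L815"
  then show "lie_bracket L815 x y \<in> carrier L815"
    unfolding L815_simps(5) by (rule L815_bracket_closed)
qed (auto simp: L815_mat_add L815_mat_smult L815_mat_bracket
  L815_mat_eq_iff L815_mat_zero algebra_simps)

end

theory Submission
  imports Defs "HOL-Analysis.Cartesian_Euclidean_Space"
begin

text \<open>The nilradical of \<open>L\<^sub>8\<^sub>.\<^sub>1\<^sub>5\<close> is generated by a two-dimensional irreducible \<open>sl(2)\<close>-module
  \<open>\<langle>P, Q\<rangle>\<close>, and triple brackets of \<open>P, Q\<close> do not vanish. In a representation on \<open>V\<close> put
  \<open>F\<^sub>0 = V\<close> and \<open>F\<^sub>i\<^sub>+\<^sub>1 = P F\<^sub>i + Q F\<^sub>i\<close>. The nilradical acts nilpotently, so the \<open>F\<^sub>i\<close> decrease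
  strictly until they vanish, and faithfulness gives \<open>F\<^sub>3 \<noteq> 0\<close>. If \<open>F\<^sub>i/F\<^sub>i\<^sub>+\<^sub>1\<close> is one-dimensional,
  \<open>sl(2)\<close> acts on it trivially, and then \<open>F\<^sub>i\<^sub>+\<^sub>1/F\<^sub>i\<^sub>+\<^sub>2\<close> is a quotient of \<open>\<langle>P, Q\<rangle>\<close>, hence not
  one-dimensional. So \<open>dim V \<ge> 6\<close>, from \<open>dim F\<^sub>0/F\<^sub>2 \<ge> 3\<close> and \<open>dim F\<^sub>2/F\<^sub>4 \<ge> 3\<close>.\<close>

section \<open>Nilpotent operators and quotients of small dimension\<close>

abbreviation lsubspace :: "'a::real_vector set \<Rightarrow> bool" where
  "lsubspace \<equiv> Real_Vector_Spaces.subspace"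

lemma linear_funpow:
  fixes S :: "'a::real_vector \<Rightarrow> 'a"
  assumes "linear S"
  shows "linear (S ^^ k)"
proof (induction k)
  case 0
  then show ?case by (simp add: linear_iff)
next
  case (Suc k)
  then show ?case using linear_compose[OF Suc assms] by (simp add: o_def)
qed

lemma funpow_mem: "(\<And>v. v \<in> F \<Longrightarrow> S v \<in> F) \<Longrightarrow> v \<in> F \<Longrightarrow> (S ^^ k) v \<in> F"
  by (induction k) auto

text \<open>If \<open>[H, S] = c S\<close> then \<open>[H, S\<^sup>k] = k c S\<^sup>k\<close>, and taking operator norms gives
  \<open>\<bar>k c\<bar> \<parallel>S\<^sup>k\<parallel> \<le> 2 \<parallel>H\<parallel> \<parallel>S\<^sup>k\<parallel>\<close>.\<close>
lemma weight_vector_nilpotent: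
  fixes H S :: "'a::euclidean_space \<Rightarrow> 'a"
  assumes H: "linear H" and S: "linear S" and c: "c \<noteq> 0"
    and HS: "\<And>v. H (S v) = S (H v) + c *\<^sub>R S v"
  shows "\<exists>k. \<forall>v. (S ^^ k) v = 0"
proof -
  have comm: "H ((S ^^ k) v) = (S ^^ k) (H v) + (real k * c) *\<^sub>R (S ^^ k) v" for k v
  proof (induction k)
    case (Suc k)
    then show ?case
      by (simp add: HS linear_add[OF S] linear_scale[OF S] algebra_simps)
  qed simp
  obtain k :: nat where k: "2 * onorm H < real k * \<bar>c\<bar>"
    using c reals_Archimedean3[of "\<bar>c\<bar>"] by auto
  let ?T = "S ^^ k"
  have bT: "bounded_linear ?T" and bH: "bounded_linear H"
    using linear_funpow[OF S] H linear_conv_bounded_linear by blast+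
  have "norm ((real k * \<bar>c\<bar>) *\<^sub>R ?T v) \<le> (2 * onorm H * onorm ?T) * norm v" for v
  proof -
    have "norm ((real k * c) *\<^sub>R ?T v) = norm (H (?T v) - ?T (H v))"
      by (simp add: comm)
    also have "\<dots> \<le> norm (H (?T v)) + norm (?T (H v))"
      by (rule norm_triangle_ineq4)
    also have "\<dots> \<le> onorm H * (onorm ?T * norm v) + onorm ?T * (onorm H * norm v)"
      by (intro add_mono order_trans[OF onorm[OF bH]] order_trans[OF onorm[OF bT]] mult_left_mono
          onorm[OF bH] onorm[OF bT] onorm_pos_le bH bT)
    finally show ?thesis by (simp add: abs_mult algebra_simps)
  qed
  then have le: "onorm (\<lambda>v. (real k * \<bar>c\<bar>) *\<^sub>R ?T v) \<le> 2 * onorm H * onorm ?T"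
    by (rule onorm_le)
  have "(real k * \<bar>c\<bar>) * onorm ?T \<le> 2 * onorm H * onorm ?T"
    using le onorm_scaleR[OF bT, of "real k * \<bar>c\<bar>"] by (simp add: abs_mult)
  then have "onorm ?T = 0"
    using k onorm_pos_le[OF bT] mult_strict_right_mono[OF k, of "onorm ?T"] by linarith
  then show ?thesis using onorm_eq_0[OF bT] by blast
qed

text \<open>A form of Nakayama's lemma: \<open>S\<close> and \<open>T\<close> are nilpotent and commute on \<open>F\<close> modulo \<open>M\<close>.\<close>
lemma nakayama_two_nilpotents:
  fixes S T :: "'a::real_vector \<Rightarrow> 'a"
  assumes M: "lsubspace M" and S: "linear S" and T: "linear T"
    and SF: "\<And>v. v \<in> F \<Longrightarrow> S v \<in> F" and TF: "\<And>v. v \<in> F \<Longrightarrow> T v \<in> F"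
    and SM: "\<And>v. v \<in> M \<Longrightarrow> S v \<in> M" and TM: "\<And>v. v \<in> M \<Longrightarrow> T v \<in> M"
    and comm: "\<And>v. v \<in> F \<Longrightarrow> S (T v) - T (S v) \<in> M"
    and nilS: "\<And>v. (S ^^ a) v = 0" and nilT: "\<And>v. (T ^^ b) v = 0"
    and gen: "\<And>v. v \<in> F \<Longrightarrow> \<exists>x\<in>F. \<exists>y\<in>F. v - (S x + T y) \<in> M"
  shows "F \<subseteq> M"
proof -
  note sub = subspace_add[OF M] subspace_diff[OF M] subspace_0[OF M]
  have commk: "(S ^^ k) (T v) - T ((S ^^ k) v) \<in> M" if "v \<in> F" for k v
  proof (induction k)
    case 0
    then show ?case by (simp add: sub)
  next
    case (Suc k)
    have "S ((S ^^ k) (T v) - T ((S ^^ k) v)) + (S (T ((S ^^ k) v)) - T (S ((S ^^ k) v))) \<in> M"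
      using Suc comm[OF funpow_mem[of F S, OF SF that]] by (intro subspace_add[OF M] SM) auto
    then show ?case by (simp add: linear_diff[OF S])
  qed
  \<comment> \<open>Induction on \<open>k\<close> lowers the power of \<open>S\<close>; nilpotency
    supplies the premise at \<open>k = a\<close>.\<close>
  have "F \<subseteq> M" if "\<And>v. v \<in> F \<Longrightarrow> (S ^^ k) v \<in> M" for k
    using that
  proof (induction k)
    case 0
    then show ?case by auto
  next
    case (Suc k)
    note lk = linear_funpow[OF S, of k]
    \<comment> \<open>Modulo \<open>M\<close>, the power \<open>S ^^ k\<close> kills
      \<open>S x\<close> by the premise and commutes with \<open>T\<close>, so only the
      \<open>T\<close> term survives. Iterating this \<open>b\<close> times kills that term
      too.\<close>
    have step: "\<exists>y\<in>F. (S ^^ k) v - T ((S ^^ k) y) \<in> M" if v: "v \<in> F" for v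
    proof -
      obtain x y where xy: "x \<in> F" "y \<in> F" "v - (S x + T y) \<in> M" using gen[OF v] by blast
      have "(S ^^ k) (v - (S x + T y)) + (S ^^ Suc k) x + ((S ^^ k) (T y) - T ((S ^^ k) y)) \<in> M"
        using xy Suc.prems commk funpow_mem[of M S, OF SM] by (intro subspace_add[OF M]) auto
      then have "(S ^^ k) v - T ((S ^^ k) y) \<in> M"
        by (simp add: linear_diff[OF lk] linear_add[OF lk] funpow_swap1)
      then show ?thesis using xy by blast
    qed
    have "\<exists>y\<in>F. (S ^^ k) v - (T ^^ m) ((S ^^ k) y) \<in> M" if v: "v \<in> F" for v m
    proof (induction m)
      case 0
      then show ?case using v by (auto simp: sub intro!: bexI[of _ v])
    next
      case (Suc m)
      then obtain y where y: "y \<in> F" "(S ^^ k) v - (T ^^ m) ((S ^^ k) y) \<in> M" by blast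
      obtain z where z: "z \<in> F" "(S ^^ k) y - T ((S ^^ k) z) \<in> M" using step y by blast
      have "((S ^^ k) v - (T ^^ m) ((S ^^ k) y)) + (T ^^ m) ((S ^^ k) y - T ((S ^^ k) z)) \<in> M"
        using y z funpow_mem[of M T, OF TM] by (intro subspace_add[OF M]) auto
      then have "(S ^^ k) v - (T ^^ Suc m) ((S ^^ k) z) \<in> M"
        by (simp add: linear_diff[OF linear_funpow[OF T]] funpow_swap1)
      then show ?case using z by blast
    qed
    from this[of _ b] have "\<And>v. v \<in> F \<Longrightarrow> (S ^^ k) v \<in> M" by (simp add: nilT)
    then show ?case by (rule Suc.IH)
  qed
  from this[of a] show ?thesis by (simp add: nilS sub)
qed

definition sumset_image :: "('a::real_vector \<Rightarrow> 'b::real_vector) \<Rightarrow> ('a \<Rightarrow> 'b) \<Rightarrow> 'a set \<Rightarrow> 'b set"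
  where "sumset_image S T F = {S x + T y | x y. x \<in> F \<and> y \<in> F}"

lemma sumset_imageI: "x \<in> F \<Longrightarrow> y \<in> F \<Longrightarrow> S x + T y \<in> sumset_image S T F"
  by (auto simp: sumset_image_def)

lemma sumset_image_left: "lsubspace F \<Longrightarrow> linear T \<Longrightarrow> x \<in> F \<Longrightarrow> S x \<in> sumset_image S T F"
  using sumset_imageI[of x F 0 S T] by (simp add: subspace_0 linear_0)

lemma sumset_image_right: "lsubspace F \<Longrightarrow> linear S \<Longrightarrow> x \<in> F \<Longrightarrow> T x \<in> sumset_image S T F"
  using sumset_imageI[of 0 F x S T] by (simp add: subspace_0 linear_0)

lemma subspace_sumset_image:
  assumes F: "lsubspace F" and S: "linear S" and T: "linear T"
  shows "lsubspace (sumset_image S T F)"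
proof (rule subspaceI)
  show "0 \<in> sumset_image S T F"
    using sumset_image_left[OF F T subspace_0[OF F], of S] by (simp add: linear_0[OF S])
next
  fix u v assume "u \<in> sumset_image S T F" "v \<in> sumset_image S T F"
  then obtain x y x' y' where "u = S x + T y" "v = S x' + T y'" "x \<in> F" "y \<in> F" "x' \<in> F" "y' \<in> F"
    by (auto simp: sumset_image_def)
  then show "u + v \<in> sumset_image S T F"
    using sumset_imageI[of "x + x'" F "y + y'" S T]
    by (simp add: linear_add[OF S] linear_add[OF T] subspace_add[OF F] algebra_simps)
next
  fix c :: real and v assume "v \<in> sumset_image S T F"
  then obtain x y where "v = S x + T y" "x \<in> F" "y \<in> F"
    by (auto simp: sumset_image_def)
  then show "c *\<^sub>R v \<in> sumset_image S T F"
    using sumset_imageI[of "c *\<^sub>R x" F "c *\<^sub>R y" S T]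
    by (simp add: linear_scale[OF S] linear_scale[OF T] subspace_scale[OF F] algebra_simps)
qed

text \<open>A quotient of dimension at most one is killed by every commutator.\<close>
lemma commutator_kills_small_quotient:
  fixes F F' :: "'a::euclidean_space set"
  assumes F: "lsubspace F" and F': "lsubspace F'" and sub: "F' \<subseteq> F"
    and dm: "dim F \<le> dim F' + 1"
    and X: "linear X" and Y: "linear Y"
    and XF: "\<And>v. v \<in> F \<Longrightarrow> X v \<in> F" and YF: "\<And>v. v \<in> F \<Longrightarrow> Y v \<in> F"
    and XF': "\<And>v. v \<in> F' \<Longrightarrow> X v \<in> F'" and YF': "\<And>v. v \<in> F' \<Longrightarrow> Y v \<in> F'"
    and v: "v \<in> F"
  shows "X (Y v) - Y (X v) \<in> F'"
proof (cases "v \<in> F'")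
  case True
  then show ?thesis using XF' YF' subspace_diff[OF F'] by blast
next
  case False
  have nspan: "v \<notin> span F'" using False F' by (metis span_eq_iff)
  have "dim (span (insert v F')) = dim F' + 1"
    using nspan by (simp add: dim_insert)
  moreover have "span (insert v F') \<subseteq> F"
    using span_minimal[of "insert v F'" F] F v sub by auto
  ultimately have eq: "span (insert v F') = F"
    using subspace_dim_equal[of "span (insert v F')" F] F dm by simp
  have dec: "\<exists>c. w - c *\<^sub>R v \<in> F'" if "w \<in> F" for w
    using that eq span_breakdown_eq[of w v F'] F' by (metis span_eq_iff)
  obtain c where c: "X v - c *\<^sub>R v \<in> F'" using dec[OF XF[OF v]] by blast
  obtain d where d: "Y v - d *\<^sub>R v \<in> F'" using dec[OF YF[OF v]] by blast
  \<comment> \<open>Modulo \<open>F'\<close> the operators \<open>X\<close> and \<open>Y\<close> act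
    on \<open>v\<close> as the scalars \<open>c\<close> and \<open>d\<close>; in this combination
    everything but the commutator cancels.\<close>
  have "X (Y v - d *\<^sub>R v) - Y (X v - c *\<^sub>R v) + d *\<^sub>R (X v - c *\<^sub>R v) - c *\<^sub>R (Y v - d *\<^sub>R v) \<in> F'"
    by (intro subspace_add[OF F' _ subspace_scale[OF F' c]] subspace_diff[OF F' _ subspace_scale[OF F' d]]
        subspace_diff[OF F' XF'[OF d] YF'[OF c]])
  then show ?thesis
    by (simp add: linear_diff[OF X] linear_diff[OF Y] linear_scale[OF X] linear_scale[OF Y] algebra_simps)
qed

section \<open>Representations of the algebra by linear operators\<close>

text \<open>\<open>X, Y, H\<close> span the Levi factor; \<open>P, Q\<close> generate the nilradical, the free three-step
  nilpotent Lie algebra on two generators.\<close>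
locale L815_operators =
  fixes X Y H P Q Z E G :: "'a::euclidean_space \<Rightarrow> 'a"
  assumes lin: "linear X" "linear Y" "linear H" "linear P" "linear Q" "linear Z" "linear E" "linear G"
    and XY: "X (Y v) = Y (X v) + H v"
    and XP: "X (P v) = P (X v)" and XQ: "X (Q v) = Q (X v) + P v"
    and YP: "Y (P v) = P (Y v) + Q v" and YQ: "Y (Q v) = Q (Y v)"
    and HP: "H (P v) = P (H v) + P v" and HQ: "H (Q v) = Q (H v) - Q v"
    and HE: "H (E v) = E (H v) + E v" and HG: "H (G v) = G (H v) - G v"
    and PQ: "P (Q v) = Q (P v) + Z v"
    and PZ: "P (Z v) = Z (P v) + E v" and QZ: "Q (Z v) = Z (Q v) + G v"
    and PE: "P (E v) = E (P v)" and QE: "Q (E v) = E (Q v)"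
    and PG: "P (G v) = G (P v)" and QG: "Q (G v) = G (Q v)"
    and ZE: "Z (E v) = E (Z v)" and ZG: "Z (G v) = G (Z v)" and EG: "E (G v) = G (E v)"
begin

lemmas linear_adds = lin[THEN linear_add]

text \<open>Closure under four operators suffices, because \<open>X, Y, P, Q\<close> generate the
  Lie algebra.\<close>

definition submodule :: "'a set \<Rightarrow> bool" where
  "submodule F \<longleftrightarrow> lsubspace F \<and> (\<forall>v\<in>F. X v \<in> F \<and> Y v \<in> F \<and> P v \<in> F \<and> Q v \<in> F)"

lemma submoduleD:
  assumes "submodule F"
  shows "lsubspace F" "v \<in> F \<Longrightarrow> X v \<in> F" "v \<in> F \<Longrightarrow> Y v \<in> F" "v \<in> F \<Longrightarrow> P v \<in> F"
    "v \<in> F \<Longrightarrow> Q v \<in> F" "v \<in> F \<Longrightarrow> H v \<in> F" "v \<in> F \<Longrightarrow> Z v \<in> F" "v \<in> F \<Longrightarrow> E v \<in> F" "v \<in> F \<Longrightarrow> G v \<in> F"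
proof -
  show F: "lsubspace F" and X: "v \<in> F \<Longrightarrow> X v \<in> F" and Y: "v \<in> F \<Longrightarrow> Y v \<in> F"
    and P: "v \<in> F \<Longrightarrow> P v \<in> F" and Q: "v \<in> F \<Longrightarrow> Q v \<in> F" for v
    using assms by (auto simp: submodule_def)
  have "H v = X (Y v) - Y (X v)" "Z v = P (Q v) - Q (P v)" for v by (simp_all add: XY PQ)
  then show "v \<in> F \<Longrightarrow> H v \<in> F" and Z: "v \<in> F \<Longrightarrow> Z v \<in> F" for v
    using subspace_diff[OF F] X Y P Q by metis+
  have "E v = P (Z v) - Z (P v)" "G v = Q (Z v) - Z (Q v)" for v by (simp_all add: PZ QZ)
  then show "v \<in> F \<Longrightarrow> E v \<in> F" "v \<in> F \<Longrightarrow> G v \<in> F"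
    using subspace_diff[OF F] P Q Z by metis+
qed

text \<open>On a submodule this is the image under the whole nilradical, since \<open>P\<close> and
  \<open>Q\<close> generate it.\<close>

abbreviation rad :: "'a set \<Rightarrow> 'a set" where
  "rad \<equiv> sumset_image P Q"

lemma rad_subset: "submodule F \<Longrightarrow> rad F \<subseteq> F"
  by (auto simp: sumset_image_def intro!: subspace_add submoduleD)

text \<open>Bracketing with \<open>X\<close> or \<open>Y\<close> preserves the span of
  \<open>P\<close> and \<open>Q\<close>, so \<open>X\<close> and \<open>Y\<close> can be moved past
  them.\<close>

lemma submodule_rad:
  assumes "submodule F"
  shows "submodule (rad F)"
proof -
  note D = submoduleD[OF assms]
  have sub: "lsubspace (rad F)" by (rule subspace_sumset_image) (auto intro: D lin)
  have "X v \<in> rad F \<and> Y v \<in> rad F \<and> P v \<in> rad F \<and> Q v \<in> rad F" if vrad: "v \<in> rad F" for v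
  proof -
    obtain x y where v: "v = P x + Q y" "x \<in> F" "y \<in> F"
      using vrad by (auto simp: sumset_image_def)
    have vF: "v \<in> F" using vrad rad_subset[OF assms] by blast
    have "X v = P (X x + y) + Q (X y)" "Y v = P (Y x) + Q (x + Y y)"
      by (simp_all add: v linear_adds XP XQ YP YQ)
    moreover have "X x + y \<in> F" "x + Y y \<in> F" "X y \<in> F" "Y x \<in> F"
      using v D subspace_add[OF D(1)] by auto
    ultimately show ?thesis
      using sumset_imageI[of _ F _ P Q] sumset_image_left[OF D(1) lin(5) vF, of P]
        sumset_image_right[OF D(1) lin(4) vF, of Q] by auto
  qed
  then show ?thesis using sub by (auto simp: submodule_def)
qed

text \<open>Under \<open>H\<close> these operators have weight 1 or -1. \<open>Z\<close> has weight
  0 and escapes this argument; \<open>rad_proper\<close> handles it through \<open>P\<close> and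
  \<open>Q\<close>.\<close>

lemma nilpotent: "\<exists>k. \<forall>v. (P ^^ k) v = 0" "\<exists>k. \<forall>v. (Q ^^ k) v = 0"
  "\<exists>k. \<forall>v. (E ^^ k) v = 0" "\<exists>k. \<forall>v. (G ^^ k) v = 0"
  by (rule weight_vector_nilpotent[OF lin(3), of _ 1] weight_vector_nilpotent[OF lin(3), of _ "-1"];
      simp add: lin HP HQ HE HG)+

text \<open>The nilradical acts nilpotently: one descends along its lower central series,
  \<open>M = Z F + J \<supseteq> J = E F + G F \<supseteq> 0\<close>.\<close>
lemma rad_proper:
  assumes F: "submodule F" and gen: "rad F = F"
  shows "F \<subseteq> {0}"
proof -
  note D = submoduleD[OF F]
  define J where "J = sumset_image E G F"
  define M where "M = {Z x + j | x j. x \<in> F \<and> j \<in> J}"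
  have subJ: "lsubspace J" unfolding J_def by (rule subspace_sumset_image) (auto intro: D lin)
  have PJ: "P v \<in> J" and QJ: "Q v \<in> J" and ZJ: "Z v \<in> J" if "v \<in> J" for v
  proof -
    obtain x y where v: "v = E x + G y" "x \<in> F" "y \<in> F"
      using \<open>v \<in> J\<close> by (auto simp: J_def sumset_image_def)
    then show "P v \<in> J" "Q v \<in> J" "Z v \<in> J"
      unfolding J_def by (auto simp: linear_adds PE PG QE QG ZE ZG intro!: sumset_imageI D)
  qed
  have EJ: "E v \<in> J" and GJ: "G v \<in> J" if "v \<in> F" for v
    unfolding J_def by (auto intro!: sumset_image_left sumset_image_right D lin that)
  have MI: "Z x + j \<in> M" if "x \<in> F" "j \<in> J" for x j
    unfolding M_def using that by blast
  have subM: "lsubspace M"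
  proof (rule subspaceI)
    show "0 \<in> M"
      using MI[OF subspace_0[OF D(1)] subspace_0[OF subJ]] by (simp add: linear_0[OF lin(6)])
  next
    fix u v assume "u \<in> M" "v \<in> M"
    then obtain x j x' j' where "u = Z x + j" "v = Z x' + j'" "x \<in> F" "j \<in> J" "x' \<in> F" "j' \<in> J"
      by (auto simp: M_def)
    then have "u + v = Z (x + x') + (j + j')" "x + x' \<in> F" "j + j' \<in> J"
      using subspace_add[OF D(1)] subspace_add[OF subJ] by (auto simp: linear_adds)
    then show "u + v \<in> M" using MI by metis
  next
    fix c :: real and v assume "v \<in> M"
    then obtain x j where "v = Z x + j" "x \<in> F" "j \<in> J" by (auto simp: M_def)
    then have "c *\<^sub>R v = Z (c *\<^sub>R x) + c *\<^sub>R j" "c *\<^sub>R x \<in> F" "c *\<^sub>R j \<in> J"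
      using subspace_scale[OF D(1)] subspace_scale[OF subJ]
      by (auto simp: linear_scale[OF lin(6)] algebra_simps)
    then show "c *\<^sub>R v \<in> M" using MI by metis
  qed
  have PM: "P v \<in> M" and QM: "Q v \<in> M" if v: "v \<in> M" for v
  proof -
    obtain x j where xj: "v = Z x + j" "x \<in> F" "j \<in> J" using v by (auto simp: M_def)
    have "P v = Z (P x) + (E x + P j)" "Q v = Z (Q x) + (G x + Q j)"
      by (simp_all add: xj linear_adds PZ QZ)
    then show "P v \<in> M" "Q v \<in> M"
      using xj by (auto intro!: MI D subspace_add[OF subJ] PJ QJ EJ GJ)
  qed
  have ZM: "Z v \<in> M" if "v \<in> F" for v
    using MI[OF that subspace_0[OF subJ]] by simp
  obtain p q e g where nil: "\<And>v. (P ^^ p) v = 0" "\<And>v. (Q ^^ q) v = 0"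
      "\<And>v. (E ^^ e) v = 0" "\<And>v. (G ^^ g) v = 0"
    using nilpotent by metis
  \<comment> \<open>Modulo \<open>M\<close> the operators \<open>P\<close> and \<open>Q\<close>
    commute on \<open>F\<close>, since their bracket \<open>Z\<close> maps \<open>F\<close> into
    \<open>M\<close>.\<close>
  have "F \<subseteq> M"
  proof (rule nakayama_two_nilpotents[of M P Q F p q])
    fix v assume "v \<in> F"
    then have "v \<in> rad F" using gen by simp
    then obtain x y where "v = P x + Q y" "x \<in> F" "y \<in> F"
      by (auto simp: sumset_image_def)
    then show "\<exists>x\<in>F. \<exists>y\<in>F. v - (P x + Q y) \<in> M"
      using subspace_0[OF subM] by (metis diff_self)
  qed (auto intro: D lin subM PM QM nil simp: PQ ZM)
  have PkZ: "(P ^^ k) (Z v) - Z ((P ^^ k) v) \<in> J" if "v \<in> F" for k v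
  proof (induction k)
    case 0
    then show ?case by (simp add: subspace_0[OF subJ])
  next
    case (Suc k)
    have "P ((P ^^ k) (Z v) - Z ((P ^^ k) v)) + E ((P ^^ k) v) \<in> J"
      using Suc PJ EJ that funpow_mem[of F P, OF D(4)] by (intro subspace_add[OF subJ]) auto
    then show ?case by (simp add: linear_diff[OF lin(4)] PZ)
  qed
  text \<open>Modulo \<open>J\<close> the operator \<open>Z\<close> is central, so \<open>[P\<^sup>k, Q] = k Z P\<^sup>k\<^sup>-\<^sup>1\<close>.\<close>
  have PkQ: "(P ^^ Suc k) (Q v) - Q ((P ^^ Suc k) v) - real (Suc k) *\<^sub>R Z ((P ^^ k) v) \<in> J"
    if "v \<in> F" for k v
  proof (induction k)
    case 0
    then show ?case by (simp add: PQ subspace_0[OF subJ])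
  next
    case (Suc k)
    let ?w = "(P ^^ k) v"
    have w: "?w \<in> F" using that funpow_mem[of F P, OF D(4)] by blast
    have "P ((P ^^ Suc k) (Q v) - Q ((P ^^ Suc k) v) - real (Suc k) *\<^sub>R Z ?w) + real (Suc k) *\<^sub>R E ?w \<in> J"
      using Suc PJ EJ w by (intro subspace_add[OF subJ] subspace_scale[OF subJ]) auto
    moreover have "P ((P ^^ Suc k) (Q v) - Q ((P ^^ Suc k) v) - real (Suc k) *\<^sub>R Z ?w) + real (Suc k) *\<^sub>R E ?w
      = (P ^^ Suc (Suc k)) (Q v) - Q ((P ^^ Suc (Suc k)) v) - real (Suc (Suc k)) *\<^sub>R Z ((P ^^ Suc k) v)"
      by (simp add: linear_diff[OF lin(4)] linear_scale[OF lin(4)] linear_adds PQ PZ algebra_simps scaleR_2)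
    ultimately show ?case by metis
  qed
  \<comment> \<open>Again the power is lowered: if \<open>P ^^ Suc k\<close> maps \<open>F\<close>
    into \<open>J\<close>, then by \<open>PkQ\<close> so does \<open>Z\<close> after
    \<open>P ^^ k\<close>, and hence \<open>P ^^ k\<close> itself, because \<open>F\<close> lies in
    \<open>M\<close>.\<close>
  have "F \<subseteq> J" if "\<And>v. v \<in> F \<Longrightarrow> (P ^^ k) v \<in> J" for k
    using that
  proof (induction k)
    case 0
    then show ?case by auto
  next
    case (Suc k)
    have "(P ^^ k) v \<in> J" if v: "v \<in> F" for v
    proof -
      obtain x j where xj: "v = Z x + j" "x \<in> F" "j \<in> J"
        using v \<open>F \<subseteq> M\<close> by (auto simp: M_def)
      have "(P ^^ Suc k) (Q x) - Q ((P ^^ Suc k) x)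
          - ((P ^^ Suc k) (Q x) - Q ((P ^^ Suc k) x) - real (Suc k) *\<^sub>R Z ((P ^^ k) x)) \<in> J"
        by (intro subspace_diff[OF subJ _ PkQ[OF xj(2)]] subspace_diff[OF subJ] Suc.prems QJ D(5) xj(2))
      then have "real (Suc k) *\<^sub>R Z ((P ^^ k) x) \<in> J" by simp
      from subspace_scale[OF subJ this, of "inverse (real (Suc k))"]
      have "Z ((P ^^ k) x) \<in> J" by (simp del: of_nat_Suc)
      then have "((P ^^ k) (Z x) - Z ((P ^^ k) x)) + Z ((P ^^ k) x) + (P ^^ k) j \<in> J"
        using xj PkZ funpow_mem[of J P, OF PJ] by (intro subspace_add[OF subJ]) auto
      then show ?thesis
        by (simp add: xj linear_add[OF linear_funpow[OF lin(4)]])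
    qed
    then show ?case by (rule Suc.IH)
  qed
  from this[of p] have "F \<subseteq> J" by (simp add: nil subspace_0[OF subJ])
  show "F \<subseteq> {0}"
  \<comment> \<open>\<open>E\<close> and \<open>G\<close> commute exactly, so the last descent works
    modulo \<open>{0}\<close>.\<close>
  proof (rule nakayama_two_nilpotents[of "{0}" E G F e g])
    fix v assume "v \<in> F"
    then have "v \<in> J" using \<open>F \<subseteq> J\<close> by blast
    then show "\<exists>x\<in>F. \<exists>y\<in>F. v - (E x + G y) \<in> {0}"
      by (auto simp: J_def sumset_image_def)
  qed (auto intro: D lin nil simp: EG linear_0[OF lin(7)] linear_0[OF lin(8)])
qed

lemma rad_strict:
  assumes "submodule F" "\<not> F \<subseteq> {0}"
  shows "dim (rad F) < dim F"
proof -
  have "rad F \<noteq> F" using rad_proper assms by blast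
  then have "\<not> dim F \<le> dim (rad F)"
    using subspace_dim_equal[of "rad F" F] rad_subset assms submodule_rad submoduleD(1) by blast
  then show ?thesis by simp
qed

text \<open>If \<open>F/rad F\<close> and \<open>rad F/rad\<^sup>2 F\<close> were both one-dimensional, \<open>H\<close> would kill both, but
  \<open>[H, P] = P\<close> and \<open>[H, Q] = -Q\<close> then force \<open>rad F \<subseteq> rad\<^sup>2 F\<close>.\<close>
lemma rad_rad_dim:
  assumes F: "submodule F" and nz: "\<not> rad F \<subseteq> {0}"
  shows "dim (rad (rad F)) + 3 \<le> dim F"
proof (rule ccontr)
  assume small: "\<not> ?thesis"
  note F1 = submodule_rad[OF F]
  note F2 = submodule_rad[OF F1]
  have "\<not> F \<subseteq> {0}" using rad_subset[OF F] nz by blast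
  then have lt: "dim (rad F) < dim F" "dim (rad (rad F)) < dim (rad F)"
    using rad_strict F F1 nz by auto
  then have dims: "dim F \<le> dim (rad F) + 1" "dim (rad F) \<le> dim (rad (rad F)) + 1"
    using small by auto
  \<comment> \<open>\<open>H\<close> is the commutator of \<open>X\<close> and \<open>Y\<close>, so
    it kills a quotient of dimension at most one.\<close>
  have kill: "H v \<in> rad K" if K: "submodule K" and d: "dim K \<le> dim (rad K) + 1" and v: "v \<in> K" for K v
    using commutator_kills_small_quotient[of K "rad K" X Y v] d v rad_subset[OF K]
      submoduleD[OF K] submoduleD[OF submodule_rad[OF K]] lin by (simp add: XY)
  note D1 = submoduleD[OF F1] and D2 = submoduleD[OF F2]
  have PQ2: "P w \<in> rad (rad F)" "Q w \<in> rad (rad F)" if "w \<in> rad F" for w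
    using that sumset_image_left[OF D1(1) lin(5)] sumset_image_right[OF D1(1) lin(4)] by auto
  have "P v \<in> rad (rad F)" "Q v \<in> rad (rad F)" if v: "v \<in> F" for v
  proof -
    note D = submoduleD[OF F]
    have "P v \<in> rad F" "Q v \<in> rad F"
      using v sumset_image_left[OF D(1) lin(5)] sumset_image_right[OF D(1) lin(4)] by auto
    then have "H (P v) - P (H v) \<in> rad (rad F)" "Q (H v) - H (Q v) \<in> rad (rad F)"
      using PQ2[OF kill[OF F dims(1) v]] kill[OF F1 dims(2)] subspace_diff[OF D2(1)] by auto
    then show "P v \<in> rad (rad F)" "Q v \<in> rad (rad F)" by (simp_all add: HP HQ)
  qed
  then have "rad F \<subseteq> rad (rad F)"
    using subspace_add[OF D2(1)] by (auto simp: sumset_image_def[of P Q F])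
  then show False using dim_subset[of "rad F" "rad (rad F)"] lt by auto
qed

text \<open>As \<open>E = [P, [P, Q]]\<close>, a nonzero value of \<open>E\<close> makes the third
  filtration step nonzero, and two uses of \<open>rad_rad_dim\<close> then require dimension
  6.\<close>

lemma E_eq_0:
  assumes "DIM('a) \<le> 5"
  shows "E v = 0"
proof (rule ccontr)
  assume nz: "E v \<noteq> 0"
  define F where "F n = (rad ^^ n) UNIV" for n
  have F: "submodule (F n)" for n
    unfolding F_def by (induction n) (auto simp: submodule_rad, auto simp: submodule_def)
  have PF: "P w \<in> F (Suc n)" and QF: "Q w \<in> F (Suc n)" if "w \<in> F n" for w n
    using that sumset_image_left[OF submoduleD(1)[OF F] lin(5)]
      sumset_image_right[OF submoduleD(1)[OF F] lin(4)] by (auto simp: F_def)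
  have U: "w \<in> F 0" for w by (simp add: F_def)
  have "E v = (P (P (Q v)) - P (Q (P v))) - (P (Q (P v)) - Q (P (P v)))"
    by (simp add: PQ PZ linear_adds)
  also have "\<dots> \<in> F (Suc (Suc (Suc 0)))"
    by (intro subspace_diff[OF submoduleD(1)[OF F]] PF QF U)
  finally have nz3: "\<not> F 3 \<subseteq> {0}" using nz by (auto simp: eval_nat_numeral)
  have sub: "F (Suc n) \<subseteq> F n" for n using rad_subset[OF F[of n]] by (simp add: F_def)
  have nz1: "\<not> F 1 \<subseteq> {0}" using sub[of 1] sub[of 2] nz3 by (auto simp: eval_nat_numeral)
  \<comment> \<open>At \<open>F 0\<close> and \<open>F 2\<close>, \<open>rad_rad_dim\<close> needs
    \<open>F 1\<close> and \<open>F 3\<close> to be nonzero.\<close>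
  have "dim (F 2) + 3 \<le> dim (F 0)" "dim (F 4) + 3 \<le> dim (F 2)"
    using rad_rad_dim[OF F[of 0]] rad_rad_dim[OF F[of 2]] nz1 nz3
    by (simp_all add: F_def eval_nat_numeral)
  moreover have "dim (F 0) \<le> DIM('a)" by (rule dim_subset_UNIV)
  ultimately show False using assms by simp
qed

end

section \<open>From matrices of size \<open>N\<close> to operators on a Euclidean space\<close>

text \<open>The type fixes the dimension, so a smaller matrix is completed by zeros;
  \<open>\<phi>\<close> numbers the index type.\<close>

definition padded :: "('n::finite \<Rightarrow> nat) \<Rightarrow> nat \<Rightarrow> real mat \<Rightarrow> real^'n^'n" where
  "padded \<phi> N A = (\<chi> i j. if \<phi> i < N \<and> \<phi> j < N then A $$ (\<phi> i, \<phi> j) else 0)"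

context
  fixes \<phi> :: "'n::finite \<Rightarrow> nat" and N :: nat
  assumes \<phi>: "bij_betw \<phi> UNIV {0..<CARD('n)}" and N: "N \<le> CARD('n)"
begin

lemma padded_mult:
  assumes A: "A \<in> carrier_mat N N" and B: "B \<in> carrier_mat N N"
  shows "padded \<phi> N (A * B) = padded \<phi> N A ** padded \<phi> N B"
proof -
  have "(A * B) $$ (\<phi> i, \<phi> j) = (\<Sum>k\<in>UNIV. if \<phi> k < N then A $$ (\<phi> i, \<phi> k) * B $$ (\<phi> k, \<phi> j) else 0)"
    if "\<phi> i < N" "\<phi> j < N" for i j
  proof -
    have "(A * B) $$ (\<phi> i, \<phi> j) = (\<Sum>k\<in>{0..<N}. A $$ (\<phi> i, k) * B $$ (k, \<phi> j))"
      using A B that by (simp add: scalar_prod_def)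
    also have "\<dots> = (\<Sum>k\<in>{0..<CARD('n)}. if k < N then A $$ (\<phi> i, k) * B $$ (k, \<phi> j) else 0)"
      using N by (intro sum.mono_neutral_cong_left) auto
    also have "\<dots> = (\<Sum>k\<in>UNIV. if \<phi> k < N then A $$ (\<phi> i, \<phi> k) * B $$ (\<phi> k, \<phi> j) else 0)"
      by (rule sum.reindex_bij_betw[OF \<phi>, symmetric])
    finally show ?thesis .
  qed
  then show ?thesis
    by (auto simp: padded_def matrix_matrix_mult_def Finite_Cartesian_Product.vec_eq_iff
        intro!: sum.cong sum.neutral)
qed

lemma padded_diff:
  "A \<in> carrier_mat N N \<Longrightarrow> B \<in> carrier_mat N N \<Longrightarrow>
    padded \<phi> N (A - B) = padded \<phi> N A - padded \<phi> N B"
  by (auto simp: padded_def Finite_Cartesian_Product.vec_eq_iff)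

lemma padded_add:
  "A \<in> carrier_mat N N \<Longrightarrow> B \<in> carrier_mat N N \<Longrightarrow>
    padded \<phi> N (A + B) = padded \<phi> N A + padded \<phi> N B"
  by (auto simp: padded_def Finite_Cartesian_Product.vec_eq_iff)

lemma padded_eq_0:
  assumes A: "A \<in> carrier_mat N N" and "padded \<phi> N A = 0"
  shows "A = 0\<^sub>m N N"
proof (rule eq_matI)
  fix i j assume ij: "i < dim_row (0\<^sub>m N N :: real mat)" "j < dim_col (0\<^sub>m N N :: real mat)"
  then have "i \<in> \<phi> ` UNIV" "j \<in> \<phi> ` UNIV" using \<phi> N by (auto simp: bij_betw_def)
  then obtain i' j' where "i = \<phi> i'" "j = \<phi> j'" by auto
  moreover have "vec_nth (vec_nth (padded \<phi> N A) i') j' = 0" using assms(2) by simp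
  ultimately show "A $$ (i, j) = 0\<^sub>m N N $$ (i, j)" using ij by (simp add: padded_def)
qed (use A in auto)

end

section \<open>The lower bound and the value of \<open>mu\<close>\<close>

text \<open>A smaller representation, padded to \<open>real^5\<close>, satisfies the relations of
  \<open>L815_operators\<close>; \<open>E_eq_0\<close> then puts a nonzero element in its
  kernel.\<close>

lemma L815_no_small_faithful_rep:
  assumes "faithful_rep L815 N \<rho>"
  shows "6 \<le> N"
proof (rule ccontr)
  assume "\<not> 6 \<le> N"
  then have N: "N \<le> CARD(5)" by simp
  obtain \<phi> :: "5 \<Rightarrow> nat" where \<phi>: "bij_betw \<phi> UNIV {0..<CARD(5)}"
    using ex_bij_betw_finite_nat[of "UNIV :: 5 set"] by auto
  define L where "L a b c d e f g h = padded \<phi> N (\<rho> (L815_mat a b c d e f g h))" for a b c d e f g h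
  have car: "\<rho> (L815_mat a b c d e f g h) \<in> carrier_mat N N" for a b c d e f g h
    using assms by (fastforce simp: faithful_rep_def lie_hom_def)
  have carL: "L815_mat a b c d e f g h \<in> carrier L815" for a b c d e f g h
    unfolding L815_simps by blast
  have hom_add: "\<rho> (x + y) = \<rho> x + \<rho> y" and hom_bracket: "\<rho> (x * y - y * x) = \<rho> x * \<rho> y - \<rho> y * \<rho> x"
    if "x \<in> carrier L815" "y \<in> carrier L815" for x y
    using assms that unfolding faithful_rep_def lie_hom_def gl_simps L815_simps by blast+
  have L_add: "L (a + a') (b + b') (c + c') (d + d') (e + e') (f + f') (g + g') (h + h')
    = L a b c d e f g h + L a' b' c' d' e' f' g' h'" for a b c d e f g h a' b' c' d' e' f' g' h'
    unfolding L_def L815_mat_add[symmetric] hom_add[OF carL carL] by (rule padded_add[OF \<phi> N car car])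
  have L_bracket: "L a b c d e f g h ** L a' b' c' d' e' f' g' h' = L a' b' c' d' e' f' g' h' ** L a b c d e f g h
    + L (b * c' - b' * c) (2 * (a * b' - a' * b)) (2 * (c * a' - c' * a))
      (a * d' - a' * d + b * f' - b' * f)
      (a * e' - a' * e + b * g' - b' * g + 3 * (d * h' - d' * h))
      (c * d' - c' * d - a * f' + a' * f)
      (c * e' - c' * e - a * g' + a' * g + 3 * (f * h' - f' * h))
      (d' * f - d * f')" for a b c d e f g h a' b' c' d' e' f' g' h'
    unfolding L_def L815_mat_bracket[symmetric] hom_bracket[OF carL carL]
    by (simp add: padded_diff[OF \<phi> N mult_carrier_mat[OF car car] mult_carrier_mat[OF car car]]
        padded_mult[OF \<phi> N car car])
  have L0: "L 0 0 0 0 0 0 0 0 = 0" using L_add[of 0 0 0 0 0 0 0 0 0 0 0 0 0 0 0 0] by simp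
  have L_minus: "L (-a) (-b) (-c) (-d) (-e) (-f) (-g) (-h) = - L a b c d e f g h" for a b c d e f g h
    using L_add[of a "-a" b "-b" c "-c" d "-d" e "-e" f "-f" g "-g" h "-h"] L0
    by (simp add: eq_neg_iff_add_eq_0 add.commute)
  \<comment> \<open>\<open>L_bracket\<close> produces these left-hand sides for
    \<open>[H, Q] = -Q\<close> and \<open>[H, G] = -G\<close>.\<close>
  have Lm: "L 0 0 0 0 0 (-1) 0 0 = - L 0 0 0 0 0 1 0 0"
    "L 0 0 0 0 0 0 3 0 = - L 0 0 0 0 0 0 (-3) 0"
    using L_minus[of 0 0 0 0 0 1 0 0] L_minus[of 0 0 0 0 0 0 "-3" 0] by simp_all
  \<comment> \<open>One rule for each shape of the relations in the locale: the bracket is an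
    operator, its negative, or zero.\<close>
  have act: "A *v (B *v v) = C *v (D *v v) + K *v v" if "A ** B = C ** D + K"
    for A B C D K :: "real^5^5" and v
    using that by (metis matrix_vector_mul_assoc matrix_vector_mult_add_rdistrib)
  have act': "A *v (B *v v) = C *v (D *v v) - K *v v" if "A ** B = C ** D + (- K)"
    for A B C D K :: "real^5^5" and v
    using that by (simp add: matrix_vector_mul_assoc matrix_vector_mult_diff_rdistrib)
  have act0: "A *v (B *v v) = C *v (D *v v)" if "A ** B = C ** D"
    for A B C D :: "real^5^5" and v
    using that by (simp add: matrix_vector_mul_assoc)
  text \<open>The entries \<open>-1\<close> and \<open>-3\<close> make \<open>[P, Q] = Z\<close>, \<open>[P, Z] = E\<close> and \<open>[Q, Z] = G\<close> hold exactly.\<close>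
  interpret L815_operators
    "(*v) (L 0 1 0 0 0 0 0 0)" "(*v) (L 0 0 1 0 0 0 0 0)" "(*v) (L 1 0 0 0 0 0 0 0)"
    "(*v) (L 0 0 0 1 0 0 0 0)" "(*v) (L 0 0 0 0 0 1 0 0)" "(*v) (L 0 0 0 0 0 0 0 (-1))"
    "(*v) (L 0 0 0 0 (-3) 0 0 0)" "(*v) (L 0 0 0 0 0 0 (-3) 0)"
    by (rule L815_operators.intro; rule matrix_vector_mul_linear act act' act0;
        (rule L_bracket[THEN trans], simp add: L0 Lm))
  have "padded \<phi> N (\<rho> (L815_mat 0 0 0 0 (-3) 0 0 0)) = 0"
    using E_eq_0 unfolding L_def by (simp add: matrix_eq)
  then have z: "\<rho> (L815_mat 0 0 0 0 (-3) 0 0 0) = 0\<^sub>m N N"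
    by (rule padded_eq_0[OF \<phi> N car])
  have "padded \<phi> N (\<rho> (L815_mat 0 0 0 0 0 0 0 0)) = 0" using L0 unfolding L_def .
  then have "\<rho> (L815_mat 0 0 0 0 0 0 0 0) = 0\<^sub>m N N"
    by (rule padded_eq_0[OF \<phi> N car])
  with z have "L815_mat 0 0 0 0 (-3) 0 0 0 = L815_mat 0 0 0 0 0 0 0 0"
    using assms carL unfolding faithful_rep_def by (metis inj_onD)
  then show False by (simp add: L815_mat_eq_iff)
qed

theorem mainTheorem5:
  shows "mu L815 = 6"
  unfolding mu_def
proof (rule Least_equality)
  have "faithful_rep L815 6 (\<lambda>x. x)"
    by (auto simp: faithful_rep_def lie_hom_def)
  then show "\<exists>\<rho>. faithful_rep L815 6 \<rho>" by blast
qed (use L815_no_small_faithful_rep in blast)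

end
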